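(* Let $p$ be an odd prime, $n\ge3$, $2\le m\le n-1$, $r=n-m$, and let $I$ be the unsaturated generalized order ideal of $\mathbb{GH}(m,n)$ in which every element of $[n]$ has multiplicity $p-1$. Let $f:\mathbb{F}_p^n\to\mathbb{F}_p$ be the characteristic function of $I(\mathbb{GP})\setminus\{0\}$ (unsaturated notion) and \[ \mathcal{C}_f=\{c(s,u)=(sf(x)+u\cdot x)_{x\in\mathbb{F}_p^n\setminus0}:\ s\in\mathbb{F}_p,\ u\in\mathbb{F}_p^n\}. \] Then $\mathcal{C}_f$ is a minimal $[p^n-1,\ n+1]$ code over $\mathbb{F}_p$, whose weights are given as follows. Put $Q=(p-1)p^{n-1}$ and write $u=(v,w)$ with $v\in\mathbb{F}_p^m$, $w\in\mathbb{F}_p^{r}$, $k=\mathrm{wt}(v)$, $\delta=[w=0]$. Then $\mathrm{wt}(c(0,u))=Q$ for $u\ne0$, $\mathrm{wt}(c(s,0))=|I(\mathbb{GP})|-1=p^m+(p-1)^m(p^r-1)-1$ for $s\neq0$, and for $s\ne0$, $u\ne0$, \[ \mathrm{wt}(c(s,u))=Q-1+p^m[v=0]+(-1)^k(p-1)^{m-k}(p^r\delta-1). \]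
   Context: $[n]=\{1,\dots,n\}$; $[\,\cdot\,]$ applied to a condition is $1$ if it holds and $0$ otherwise; $u\cdot x=\sum_i u_ix_i$; $\mathrm{wt}$ is Hamming weight. An $[N,k]$ code is a linear code of length $N$ and dimension $k$. A nonzero codeword $c$ of a linear code $\mathcal{C}$ over $\mathbb{F}_p$ is minimal if $c'\in\mathcal{C}$ and $\mathrm{supp}(c')\subseteq\mathrm{supp}(c)$ imply $c'\in\mathbb{F}_pc$; $\mathcal{C}$ is minimal if all its nonzero codewords are. Generalized order ideals: $[n]_{p-1}$ is the multiset in which each $i\in[n]$ has multiplicity $p-1$. A sub-multiset $J$ is identified with its multiplicity vector $(J_1,\dots,J_n)\in\{0,\dots,p-1\}^n=\mathbb{F}_p^n$; $J\subseteq J'$ means $J_i\le J'_i$ (as integers) for all $i$; $\bar J=\{i:J_i\ne0\}$. The hierarchical poset $\mathbb{H}(m,n)$ on $[n]$ has as its only strict relations $i\prec j$ for all $i\in[m]$, $j\in[n]\setminus[m]$; $\mathbb{GH}(m,n)$ denotes $[n]_{p-1}$ together with this order. $J$ is an unsaturated generalized order ideal if $\bar J$ is an order ideal (down-closed subset) of $\mathbb{H}(m,n)$. For an unsaturated generalized order ideal $I$, $I(\mathbb{GP})\subseteq\mathbb{F}_p^n$ is the set of all unsaturated generalized order ideals contained in $I$. Thus for the $I$ considered here, $I(\mathbb{GP})=(\mathbb{F}_p^m\times0)\cup((\mathbb{F}_p^* )^m\times(\mathbb{F}_p^{r}\setminus0))$. *)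

theory Defs
  imports
    "HOL-Computational_Algebra.Primes"
    "HOL-Library.Cardinality"
    "HOL-Library.Multiset"
    "HOL-Library.Function_Algebras"
    "HOL-Library.Indicator_Function"
    "Jordan_Normal_Form.Matrix"
begin

section \<open>Linear codes over a field\<close>

text \<open>
  A word of length \<open>N\<close> is a function on an arbitrary coordinate set \<open>D\<close> with \<open>N\<close> elements,
  extended by 0 outside \<open>D\<close>. The extension makes words with pointwise operations a vector space.
\<close>

global_interpretation word_space:
  vector_space "\<lambda>(a::'a::field) (c::'b \<Rightarrow> 'a) x. a * c x"
  by unfold_locales (auto simp: fun_eq_iff algebra_simps)

definition supp :: "('b \<Rightarrow> 'a::zero) \<Rightarrow> 'b set" where
  "supp c = {x. c x \<noteq> 0}"

definition wt :: "('b \<Rightarrow> 'a::zero) \<Rightarrow> nat" where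
  "wt c = card (supp c)"

definition linear_code :: "'b set \<Rightarrow> nat \<Rightarrow> nat \<Rightarrow> ('b \<Rightarrow> 'a::field) set \<Rightarrow> bool" where
  "linear_code D N k C \<longleftrightarrow>
     finite D \<and> card D = N \<and> (\<forall>c\<in>C. supp c \<subseteq> D) \<and>
     word_space.subspace C \<and> word_space.dim C = k"

definition minimal_codeword :: "('b \<Rightarrow> 'a::field) set \<Rightarrow> ('b \<Rightarrow> 'a) \<Rightarrow> bool" where
  "minimal_codeword C c \<longleftrightarrow>
     c \<in> C \<and> c \<noteq> 0 \<and> (\<forall>c'\<in>C. supp c' \<subseteq> supp c \<longrightarrow> (\<exists>a. c' = (\<lambda>x. a * c x)))"

definition minimal_code :: "('b \<Rightarrow> 'a::field) set \<Rightarrow> bool" where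
  "minimal_code C \<longleftrightarrow> (\<forall>c\<in>C. c \<noteq> 0 \<longrightarrow> minimal_codeword C c)"

definition wt_vec :: "'a::zero vec \<Rightarrow> nat" where
  "wt_vec v = card {i. i < dim_vec v \<and> v $ i \<noteq> 0}"

section \<open>Generalized order ideals\<close>

text \<open>The strict order of the hierarchical poset \<open>H(m,n)\<close> on \<open>{1..n}\<close>.\<close>

definition hier_less :: "nat \<Rightarrow> nat \<Rightarrow> nat \<Rightarrow> nat \<Rightarrow> bool" where
  "hier_less m n i j \<longleftrightarrow> i \<in> {1..m} \<and> j \<in> {1..n} - {1..m}"

definition order_ideal :: "nat \<Rightarrow> (nat \<Rightarrow> nat \<Rightarrow> bool) \<Rightarrow> nat set \<Rightarrow> bool" where
  "order_ideal n lt A \<longleftrightarrow> A \<subseteq> {1..n} \<and> (\<forall>j\<in>A. \<forall>i\<in>{1..n}. lt i j \<longrightarrow> i \<in> A)"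

definition unsat_ideal :: "nat \<Rightarrow> nat \<Rightarrow> (nat \<Rightarrow> nat \<Rightarrow> bool) \<Rightarrow> nat multiset \<Rightarrow> bool" where
  "unsat_ideal p n lt J \<longleftrightarrow>
     J \<subseteq># repeat_mset (p - 1) (mset_set {1..n}) \<and> order_ideal n lt (set_mset J)"

text \<open>
  The multiplicity vector in \<open>F_p^n\<close>; the type \<open>'a\<close> will be a field with \<open>p\<close> elements, where
  \<open>of_nat\<close> identifies \<open>{0..p-1}\<close> with the field. Library vectors are indexed from 0, so entry
  \<open>i\<close> belongs to the element \<open>i + 1\<close> of \<open>{1..n}\<close>.
\<close>

definition mult_vec :: "nat \<Rightarrow> nat multiset \<Rightarrow> 'a::semiring_1 vec" where
  "mult_vec n J = vec n (\<lambda>i. of_nat (count J (Suc i)))"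

definition ideal_vecs ::
    "nat \<Rightarrow> nat \<Rightarrow> (nat \<Rightarrow> nat \<Rightarrow> bool) \<Rightarrow> nat multiset \<Rightarrow> 'a::semiring_1 vec set" where
  "ideal_vecs p n lt I = mult_vec n ` {J. unsat_ideal p n lt J \<and> J \<subseteq># I}"

section \<open>The code of a function\<close>

definition nonzero_vecs :: "nat \<Rightarrow> 'a::zero vec set" where
  "nonzero_vecs n = carrier_vec n - {0\<^sub>v n}"

definition codeword ::
    "nat \<Rightarrow> ('a::field vec \<Rightarrow> 'a) \<Rightarrow> 'a \<Rightarrow> 'a vec \<Rightarrow> 'a vec \<Rightarrow> 'a" where
  "codeword n f s u = (\<lambda>x. if x \<in> nonzero_vecs n then s * f x + u \<bullet> x else 0)"

definition code_of :: "nat \<Rightarrow> ('a::field vec \<Rightarrow> 'a) \<Rightarrow> ('a vec \<Rightarrow> 'a) set" where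
  "code_of n f = {codeword n f s u | s u. u \<in> carrier_vec n}"

end

theory Submission
  imports Defs "HOL-Number_Theory.Residues"
begin

text \<open>
  The vectors of the ideal are those of \<open>X = (F\<^sup>m \<times> 0) \<union> ((F\<^sup>*)\<^sup>m \<times> (F\<^sup>r - 0))\<close>
  (\<open>ideal_vecs_eq_hier_ideal\<close>), and \<open>f\<close> is the characteristic function of \<open>X\<close> without the zero
  vector.

  Weights. For \<open>s \<noteq> 0\<close> and \<open>u \<noteq> 0\<close> the word \<open>c(s, u)\<close> vanishes at \<open>x\<close> iff \<open>f x = 0\<close> and
  \<open>u \<bullet> x = 0\<close>, or \<open>f x = 1\<close> and \<open>u \<bullet> x = - s\<close>. Its weight is therefore \<open>Q - 1\<close> plus the bias of
  \<open>u\<close> on \<open>X\<close>, that is, the number of \<open>x\<close> in \<open>X\<close> with \<open>u \<bullet> x = 0\<close> minus the number of those with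
  \<open>u \<bullet> x = - s\<close> (\<open>wt_codeword_bias\<close>). The bias is additive. On a full space it vanishes unless the
  functional is zero, and on \<open>(F\<^sup>*)\<^sup>m\<close> it is \<open>(-1)\<^sup>k (p - 1)\<^sup>m\<^sup>-\<^sup>k\<close>, where \<open>k\<close> is the weight of the
  functional (\<open>bias_nowhere_zero\<close>). Combining these over the blocks of \<open>X\<close> gives the formula
  (\<open>bias_hier_ideal\<close>).

  Minimality. Comparing weights is not needed; it suffices to look at zeros. A word that vanishes on
  the kernel of a linear functional has no component along \<open>f\<close>, because \<open>f\<close> is even, linear
  functionals are odd, and the kernel meets \<open>X\<close> outside the origin (\<open>no_ideal_coefficient\<close>). The
  zeros of a word \<open>c(s, u)\<close> with \<open>s \<noteq> 0\<close> span the space (\<open>zeros_span\<close>), so from any word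
  whose support lies in that of \<open>c(s, u)\<close>, subtracting the multiple of \<open>c(s, u)\<close> that cancels \<open>f\<close>
  leaves zero. The first of these two facts also shows that \<open>(s, u)\<close> is determined by \<open>c(s, u)\<close>, whence the dimension \<open>n + 1\<close>.
\<close>

section \<open>Vectors over a finite field\<close>

text \<open>
  The vectors of length \<open>n\<close> whose entries all lie in \<open>S\<close>. The cases used are \<open>S = UNIV\<close>, the whole
  space, and \<open>S = - {0}\<close>, the vectors without a zero entry.
\<close>

definition vecs_over :: "'a set \<Rightarrow> nat \<Rightarrow> 'a vec set" where
  "vecs_over S n = {x \<in> carrier_vec n. \<forall>i<n. x $ i \<in> S}"

lemma vecs_over_UNIV: "vecs_over UNIV n = carrier_vec n"
  by (simp add: vecs_over_def)

lemma vecs_over_carrier: "x \<in> vecs_over S n \<Longrightarrow> x \<in> carrier_vec n"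
  by (simp add: vecs_over_def)

lemma vecs_over_0: "vecs_over S 0 = {vNil}"
  by (auto simp: vecs_over_def)

lemma vecs_over_Suc: "vecs_over S (Suc n) = (\<lambda>(a, x). vCons a x) ` (S \<times> vecs_over S n)"
proof (intro equalityI subsetI)
  fix x assume x: "x \<in> vecs_over S (Suc n)"
  show "x \<in> (\<lambda>(a, x). vCons a x) ` (S \<times> vecs_over S n)"
  proof (cases x)
    case (vCons a y)
    with x have "a \<in> S" "y \<in> vecs_over S n"
      by (auto simp: vecs_over_def All_less_Suc2)
    with vCons show ?thesis by force
  qed (use x in \<open>auto simp: vecs_over_def\<close>)
qed (auto simp: vecs_over_def All_less_Suc2)

lemma inj_on_vCons: "inj_on (\<lambda>(a, x). vCons a x) A"
  by (auto simp: inj_on_def)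

lemma card_vecs_over: "card (vecs_over S n) = card S ^ n"
  by (induction n)
    (simp_all add: vecs_over_0 vecs_over_Suc card_image[OF inj_on_vCons] card_cartesian_product)

lemma card_carrier_vec: "card (carrier_vec n :: 'a vec set) = CARD('a) ^ n"
  using card_vecs_over[of "UNIV :: 'a set" n] by (simp add: vecs_over_UNIV)

lemma finite_vecs_over: "finite S \<Longrightarrow> finite (vecs_over S n)"
  by (induction n) (simp_all add: vecs_over_0 vecs_over_Suc)

lemma finite_carrier_vec: "finite (carrier_vec n :: 'a::finite vec set)"
  using finite_vecs_over[of "UNIV :: 'a set" n] by (simp add: vecs_over_UNIV)

lemma int_card_nonzero: "int (card (- {0 :: 'a::{finite,zero}})) = int CARD('a) - 1"
  by (simp add: Compl_eq_Diff_UNIV card_Diff_singleton)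

lemma finite_nonzero_vecs: "finite (nonzero_vecs n :: 'a::{finite,zero} vec set)"
  by (simp add: nonzero_vecs_def finite_carrier_vec)

lemma card_nonzero_vecs: "card (nonzero_vecs n :: 'a::{finite,zero} vec set) = CARD('a) ^ n - 1"
  by (simp add: nonzero_vecs_def card_carrier_vec finite_carrier_vec)

lemma exists_scalar_prod_eq:
  fixes u :: "'a::field vec"
  assumes u: "u \<in> carrier_vec n" "u \<noteq> 0\<^sub>v n"
  obtains x where "x \<in> carrier_vec n" "u \<bullet> x = t"
proof -
  obtain i where i: "i < n" "u $ i \<noteq> 0"
    using u by (metis carrier_vecD eq_vecI index_zero_vec)
  have "u \<bullet> ((t / u $ i) \<cdot>\<^sub>v unit_vec n i) = t"
    using u i by (subst scalar_prod_smult_distrib[of _ n]) auto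
  then show thesis by (rule that[rotated]) auto
qed

lemma card_hyperplane:
  fixes u :: "'a::{finite,field} vec"
  assumes u: "u \<in> carrier_vec n" "u \<noteq> 0\<^sub>v n"
  shows "card {x \<in> carrier_vec n. u \<bullet> x = t} = CARD('a) ^ (n - 1)"
proof -
  define H where "H t = {x \<in> carrier_vec n. u \<bullet> x = t}" for t
  have H: "card (H t) = card (H 0)" for t
  proof -
    obtain a where a: "a \<in> carrier_vec n" "u \<bullet> a = t"
      using exists_scalar_prod_eq[OF u] .
    have "bij_betw (\<lambda>x. x + a) (H 0) (H t)"
      using u a
      by (intro bij_betw_byWitness[where f' = "\<lambda>x. x - a"])
        (auto simp: H_def scalar_prod_add_distrib[of _ n] scalar_prod_minus_distrib[of _ n])
    then show ?thesis by (simp add: bij_betw_same_card)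
  qed
  have "n \<noteq> 0" using u by (auto intro: eq_vecI)
  have "CARD('a) ^ n = card (carrier_vec n :: 'a vec set)" by (simp add: card_carrier_vec)
  also have "carrier_vec n = (\<Union>t. H t)" by (auto simp: H_def)
  also have "card \<dots> = (\<Sum>t\<in>UNIV. card (H t))"
    by (rule card_UN_disjoint) (auto simp: H_def finite_carrier_vec)
  also have "\<dots> = (\<Sum>t\<in>(UNIV :: 'a set). card (H 0))"
    by (rule sum.cong[OF refl H])
  also have "\<dots> = CARD('a) * card (H t)" using H[of t] by simp
  finally show ?thesis using \<open>n \<noteq> 0\<close> by (cases n) (auto simp: H_def)
qed

lemma scalar_prod_nondegenerate:
  fixes y :: "'a::field vec"
  assumes y: "y \<in> carrier_vec n" and "\<And>x. x \<in> carrier_vec n \<Longrightarrow> y \<bullet> x = 0"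
  shows "y = 0\<^sub>v n"
  using exists_scalar_prod_eq[OF y, of 1] assms(2) by (metis zero_neq_one)

text \<open>
  An affine hyperplane that misses the origin spans the whole space, so only the zero functional
  vanishes on it.
\<close>

lemma vanishing_on_affine_hyperplane:
  fixes v y :: "'a::field vec"
  assumes v: "v \<in> carrier_vec n" "v \<noteq> 0\<^sub>v n" and t: "t \<noteq> 0" and y: "y \<in> carrier_vec n"
    and van: "\<And>x. x \<in> carrier_vec n \<Longrightarrow> v \<bullet> x = t \<Longrightarrow> y \<bullet> x = 0"
  shows "y = 0\<^sub>v n"
proof (rule scalar_prod_nondegenerate[OF y])
  fix h :: "'a vec" assume h: "h \<in> carrier_vec n"
  show "y \<bullet> h = 0"
  proof (cases "v \<bullet> h = 0")
    case True
    obtain a where a: "a \<in> carrier_vec n" "v \<bullet> a = t" using exists_scalar_prod_eq[OF v] .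
    have "y \<bullet> (a + h) = 0"
      using a h True v by (intro van) (simp_all add: scalar_prod_add_distrib[of _ n])
    then show ?thesis using van[OF a] a h y by (simp add: scalar_prod_add_distrib[of _ n])
  next
    case False
    have "y \<bullet> ((t / (v \<bullet> h)) \<cdot>\<^sub>v h) = 0"
      using h False v by (intro van) (simp_all add: scalar_prod_smult_distrib[of _ n])
    then show ?thesis using False t h y by (simp add: scalar_prod_smult_distrib[of _ n])
  qed
qed

lemma vanishing_on_hyperplane:
  fixes u y :: "'a::field vec"
  assumes u: "u \<in> carrier_vec n" "u \<noteq> 0\<^sub>v n" and y: "y \<in> carrier_vec n"
    and van: "\<And>x. x \<in> carrier_vec n \<Longrightarrow> u \<bullet> x = 0 \<Longrightarrow> y \<bullet> x = 0"
  shows "\<exists>a. y = a \<cdot>\<^sub>v u"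
proof -
  obtain e where e: "e \<in> carrier_vec n" "u \<bullet> e = 1" using exists_scalar_prod_eq[OF u] .
  have "y - (y \<bullet> e) \<cdot>\<^sub>v u = 0\<^sub>v n"
  proof (rule scalar_prod_nondegenerate)
    fix h :: "'a vec" assume h: "h \<in> carrier_vec n"
    have "y \<bullet> (h - (u \<bullet> h) \<cdot>\<^sub>v e) = 0"
      using e h u by (intro van)
        (simp_all add: scalar_prod_minus_distrib[of _ n] scalar_prod_smult_distrib[of _ n])
    then show "(y - (y \<bullet> e) \<cdot>\<^sub>v u) \<bullet> h = 0"
      using e h u y by (simp add: scalar_prod_minus_distrib[of _ n]
          scalar_prod_smult_distrib[of _ n] minus_scalar_prod_distrib[of _ n])
  qed (use u y in simp)
  then have "y $ i = (y \<bullet> e) * u $ i" if "i < n" for i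
    using that u y by (auto simp: vec_eq_iff)
  then have "y = (y \<bullet> e) \<cdot>\<^sub>v u" using u y by (intro eq_vecI) auto
  then show ?thesis ..
qed

section \<open>Bias of a linear functional on a set of vectors\<close>

text \<open>
  The number of zeros of the functional \<open>u\<close> on \<open>X\<close> minus the number of points of \<open>X\<close> where it
  takes the value \<open>c\<close>. It is written as a sum, which is additive in \<open>X\<close> and iterates over products.
\<close>

definition bias :: "'a::field vec \<Rightarrow> 'a \<Rightarrow> 'a vec set \<Rightarrow> int" where
  "bias u c X = (\<Sum>x\<in>X. of_bool (u \<bullet> x = 0) - of_bool (u \<bullet> x = c))"

lemma bias_eq_card:
  "finite X \<Longrightarrow>
     bias u c X = int (card {x \<in> X. u \<bullet> x = 0}) - int (card {x \<in> X. u \<bullet> x = c})"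
  by (simp add: bias_def sum_subtractf sum_of_bool_eq Collect_conj_eq)

lemma bias_carrier_vec:
  fixes u :: "'a::{finite,field} vec"
  assumes u: "u \<in> carrier_vec n" and c: "c \<noteq> 0"
  shows "bias u c (carrier_vec n) = int CARD('a) ^ n * of_bool (u = 0\<^sub>v n)"
proof (cases "u = 0\<^sub>v n")
  case True
  have "bias u c (carrier_vec n) = (\<Sum>x\<in>(carrier_vec n :: 'a vec set). 1)"
    unfolding bias_def using True c by (intro sum.cong) auto
  then show ?thesis using True by (simp add: card_carrier_vec)
next
  case False
  then show ?thesis
    by (simp add: bias_eq_card finite_carrier_vec card_hyperplane[OF u])
qed

lemma wt_vec_vCons: "wt_vec (vCons a v) = of_bool (a \<noteq> 0) + wt_vec v"
proof -
  have "{i. i < dim_vec (vCons a v) \<and> vCons a v $ i \<noteq> 0}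
        = (if a \<noteq> 0 then {0} else {}) \<union> Suc ` {i. i < dim_vec v \<and> v $ i \<noteq> 0}"
  proof (rule Set.set_eqI)
    fix i show "i \<in> {i. i < dim_vec (vCons a v) \<and> vCons a v $ i \<noteq> 0} \<longleftrightarrow>
       i \<in> (if a \<noteq> 0 then {0} else {}) \<union> Suc ` {i. i < dim_vec v \<and> v $ i \<noteq> 0}"
      by (cases i) auto
  qed
  also have "card \<dots> = card (if a \<noteq> 0 then {0::nat} else {})
      + card (Suc ` {i. i < dim_vec v \<and> v $ i \<noteq> 0})"
    by (rule card_Un_disjoint) auto
  finally show ?thesis by (simp add: wt_vec_def card_image)
qed

lemma wt_vec_le_dim: "wt_vec v \<le> dim_vec v"
proof -
  have "wt_vec v \<le> card {..<dim_vec v}"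
    unfolding wt_vec_def by (rule card_mono) auto
  then show ?thesis by simp
qed

text \<open>
  On the vectors without a zero entry the bias is a product over the coordinates of \<open>u\<close>: a zero
  coordinate gives the factor \<open>q - 1\<close> with \<open>q\<close> the size of the field, since the matching entry of
  the vector does not affect the value. A nonzero coordinate gives the factor \<open>-1\<close>: for fixed other
  entries, the value avoids the contribution of those entries and is every other element once.
\<close>

lemma bias_nowhere_zero:
  fixes u :: "'a::{finite,field} vec"
  assumes "u \<in> carrier_vec n" "c \<noteq> 0"
  shows "bias u c (vecs_over (- {0}) n)
    = (- 1) ^ wt_vec u * (int CARD('a) - 1) ^ (n - wt_vec u)"
  using assms(1)
proof (induction n arbitrary: u)
  case 0
  then show ?case using assms(2) by (simp add: vecs_over_0 bias_def wt_vec_def)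
next
  case (Suc n)
  let ?E = "vecs_over (- {0}) n :: 'a vec set"
  obtain a v where u: "u = vCons a v" and v: "v \<in> carrier_vec n"
    using Suc.prems by (cases u) auto
  have wt: "wt_vec v \<le> n" using wt_vec_le_dim[of v] v by simp
  have "bias u c (vecs_over (- {0}) (Suc n))
    = (\<Sum>(b, x)\<in>(- {0}) \<times> ?E. of_bool (a * b + v \<bullet> x = 0) - of_bool (a * b + v \<bullet> x = c))"
    unfolding bias_def vecs_over_Suc u
    by (subst sum.reindex[OF inj_on_vCons]) (simp add: case_prod_unfold o_def)
  also have "\<dots> = (\<Sum>x\<in>?E. \<Sum>b\<in>- {0}. of_bool (a * b + v \<bullet> x = 0) - of_bool (a * b + v \<bullet> x = c))"
    by (subst sum.cartesian_product[symmetric], subst sum.swap) simp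
  also have "\<dots> = (if a = 0 then int CARD('a) - 1 else - 1) * bias v c ?E"
  proof (cases "a = 0")
    case True
    then show ?thesis by (simp add: bias_def sum_distrib_left int_card_nonzero)
  next
    case False
    \<comment> \<open>The equation has a unique solution \<open>b\<close>, which is excluded exactly if it is 0.\<close>
    have solve: "(\<Sum>b\<in>- {0}. of_bool (a * b + t = d)) = (1 :: int) - of_bool (t = d)" for t d
    proof -
      have "- {0} \<inter> {b. a * b + t = d} = (if t = d then {} else {(d - t) / a})"
        using False by (auto simp: field_simps)
      then show ?thesis by (simp add: sum_of_bool_eq)
    qed
    show ?thesis
      using False by (simp add: bias_def sum_subtractf solve sum_negf[symmetric])
  qed
  finally show ?case
    using Suc.IH[OF v] wt by (auto simp: u wt_vec_vCons Suc_diff_le)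
qed

text \<open>
  Summing over a free block on which \<open>w\<close> acts nontrivially makes all values equally frequent, so
  only \<open>w = 0\<close> contributes.
\<close>

lemma bias_indep:
  fixes w :: "'a::{finite,field} vec"
  assumes w: "w \<in> carrier_vec r"
  shows "(\<Sum>y\<in>carrier_vec r. of_bool (t + w \<bullet> y = 0) - of_bool (t + w \<bullet> y = c))
    = int CARD('a) ^ r * of_bool (w = 0\<^sub>v r) * (of_bool (t = 0) - of_bool (t = c))"
proof (cases "w = 0\<^sub>v r")
  case True
  have "(\<Sum>y\<in>carrier_vec r. of_bool (t + w \<bullet> y = 0) - of_bool (t + w \<bullet> y = c))
    = (\<Sum>y\<in>(carrier_vec r :: 'a vec set). of_bool (t = 0) - of_bool (t = c) :: int)"
    using True by (intro sum.cong) auto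
  then show ?thesis using True by (simp add: card_carrier_vec)
next
  case False
  have "card (carrier_vec r \<inter> {y. t + w \<bullet> y = d}) = CARD('a) ^ (r - 1)" for d
  proof -
    have "carrier_vec r \<inter> {y. t + w \<bullet> y = d} = {y \<in> carrier_vec r. w \<bullet> y = d - t}"
      by (auto simp: algebra_simps)
    then show ?thesis using card_hyperplane[OF w False] by simp
  qed
  then show ?thesis
    using False by (simp add: sum_subtractf sum_of_bool_eq finite_carrier_vec)
qed

section \<open>Splitting a vector into two blocks\<close>

lemma append_vec_cases:
  assumes "x \<in> carrier_vec (m + r)"
  obtains a b where "x = a @\<^sub>v b" "a \<in> carrier_vec m" "b \<in> carrier_vec r"
  using that[of "vec_first x m" "vec_last x r"] assms by simp

lemma append_eq_zero_iff:
  assumes "a \<in> carrier_vec m"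
  shows "a @\<^sub>v b = 0\<^sub>v (m + r) \<longleftrightarrow> a = 0\<^sub>v m \<and> b = 0\<^sub>v r"
proof -
  have "0\<^sub>v (m + r) = 0\<^sub>v m @\<^sub>v (0\<^sub>v r :: 'a vec)" by (rule eq_vecI) auto
  then show ?thesis using append_vec_eq[OF assms, of "0\<^sub>v m"] by simp
qed

section \<open>The hierarchical ideal as a set of vectors\<close>

text \<open>
  The set \<open>(F\<^sup>m \<times> 0) \<union> ((F\<^sup>*)\<^sup>m \<times> (F\<^sup>r - 0))\<close> of concatenated vectors. The zero vector belongs
  to it.
\<close>

definition hier_ideal :: "nat \<Rightarrow> nat \<Rightarrow> 'a::zero vec set" where
  "hier_ideal m r =
     (\<lambda>(a, b). a @\<^sub>v b) ` (carrier_vec m \<times> {0\<^sub>v r} \<union> vecs_over (- {0}) m \<times> nonzero_vecs r)"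

lemma append_mem_hier_ideal:
  assumes "a \<in> carrier_vec m" "b \<in> carrier_vec r"
  shows "a @\<^sub>v b \<in> hier_ideal m r \<longleftrightarrow> b = 0\<^sub>v r \<or> a \<in> vecs_over (- {0}) m"
proof
  assume "a @\<^sub>v b \<in> hier_ideal m r"
  then obtain a' b' where ab: "a @\<^sub>v b = a' @\<^sub>v b'" and a': "a' \<in> carrier_vec m"
    and "b' = 0\<^sub>v r \<or> a' \<in> vecs_over (- {0}) m"
    by (auto simp: hier_ideal_def vecs_over_carrier)
  moreover have "a = a' \<and> b = b'"
    using ab append_vec_eq[OF assms(1) a'] by blast
  ultimately show "b = 0\<^sub>v r \<or> a \<in> vecs_over (- {0}) m" by simp
next
  assume "b = 0\<^sub>v r \<or> a \<in> vecs_over (- {0}) m"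
  then have "(a, b) \<in> carrier_vec m \<times> {0\<^sub>v r} \<union> vecs_over (- {0}) m \<times> nonzero_vecs r"
    using assms by (auto simp: nonzero_vecs_def)
  then show "a @\<^sub>v b \<in> hier_ideal m r"
    unfolding hier_ideal_def by (rule rev_image_eqI) simp
qed

lemma inj_on_append_vec:
  "inj_on (\<lambda>(a, b). a @\<^sub>v b) (carrier_vec m \<times> {0\<^sub>v r} \<union> vecs_over (- {0}) m \<times> nonzero_vecs r)"
proof (rule inj_onI, clarify)
  fix a b a' b'
  assume "(a, b) \<in> carrier_vec m \<times> {0\<^sub>v r} \<union> vecs_over (- {0}) m \<times> nonzero_vecs r"
    and "(a', b') \<in> carrier_vec m \<times> {0\<^sub>v r} \<union> vecs_over (- {0}) m \<times> nonzero_vecs r"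
    and eq: "a @\<^sub>v b = a' @\<^sub>v b'"
  then have a: "a \<in> carrier_vec m" "a' \<in> carrier_vec m"
    by (auto simp: vecs_over_carrier)
  show "a = a' \<and> b = b'" using eq append_vec_eq[OF a] by blast
qed

lemma hier_ideal_subset_carrier: "hier_ideal m r \<subseteq> carrier_vec (m + r)"
  by (auto simp: hier_ideal_def nonzero_vecs_def dest: vecs_over_carrier)

lemma zero_mem_hier_ideal: "(0\<^sub>v (m + r) :: 'a::zero vec) \<in> hier_ideal m r"
  using append_mem_hier_ideal[of "0\<^sub>v m :: 'a vec" m "0\<^sub>v r" r]
    append_eq_zero_iff[of "0\<^sub>v m :: 'a vec" m "0\<^sub>v r" r] by simp

text \<open>
  The two parts of the ideal are disjoint and concatenation is injective on them, so sums over the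
  ideal are iterated sums over the blocks.
\<close>

lemma sum_hier_ideal:
  "sum g (hier_ideal m r :: 'a::{finite,zero} vec set)
    = (\<Sum>a\<in>carrier_vec m. g (a @\<^sub>v 0\<^sub>v r))
      + (\<Sum>a\<in>vecs_over (- {0}) m. \<Sum>b\<in>nonzero_vecs r. g (a @\<^sub>v b))"
proof -
  have "sum g (hier_ideal m r) = (\<Sum>(a, b)\<in>carrier_vec m \<times> {0\<^sub>v r}. g (a @\<^sub>v b))
      + (\<Sum>(a, b)\<in>vecs_over (- {0}) m \<times> nonzero_vecs r. g (a @\<^sub>v b))"
    unfolding hier_ideal_def sum.reindex[OF inj_on_append_vec]
    by (subst sum.union_disjoint)
      (auto simp: finite_carrier_vec finite_vecs_over finite_nonzero_vecs nonzero_vecs_def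
        case_prod_unfold)
  then show ?thesis by (simp add: sum.cartesian_product[symmetric])
qed

lemma card_hier_ideal:
  "int (card (hier_ideal m r :: 'a::{finite,zero} vec set))
    = int CARD('a) ^ m + (int CARD('a) - 1) ^ m * (int CARD('a) ^ r - 1)"
proof -
  have "int (card (hier_ideal m r :: 'a vec set)) = (\<Sum>x\<in>(hier_ideal m r :: 'a vec set). 1)"
    by simp
  then show ?thesis
    by (simp only: sum_hier_ideal)
      (simp add: card_carrier_vec card_vecs_over card_nonzero_vecs int_card_nonzero of_nat_diff)
qed

lemma bias_hier_ideal:
  fixes v w :: "'a::{finite,field} vec"
  assumes v: "v \<in> carrier_vec m" and w: "w \<in> carrier_vec r" and c: "c \<noteq> 0"
  shows "bias (v @\<^sub>v w) c (hier_ideal m r) =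
    int CARD('a) ^ m * of_bool (v = 0\<^sub>v m)
      + (- 1) ^ wt_vec v * (int CARD('a) - 1) ^ (m - wt_vec v)
        * (int CARD('a) ^ r * of_bool (w = 0\<^sub>v r) - 1)"
proof -
  let ?E = "vecs_over (- {0}) m :: 'a vec set"
  let ?h = "\<lambda>t. of_bool (t = 0) - of_bool (t = c) :: int"
  have prod: "(v @\<^sub>v w) \<bullet> (a @\<^sub>v b) = v \<bullet> a + w \<bullet> b"
    if "a \<in> carrier_vec m" "b \<in> carrier_vec r" for a b
    using scalar_prod_append[OF v w that] .
  have "bias (v @\<^sub>v w) c (hier_ideal m r) = (\<Sum>a\<in>carrier_vec m. ?h ((v @\<^sub>v w) \<bullet> (a @\<^sub>v 0\<^sub>v r)))
      + (\<Sum>a\<in>?E. \<Sum>b\<in>nonzero_vecs r. ?h ((v @\<^sub>v w) \<bullet> (a @\<^sub>v b)))"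
    unfolding bias_def sum_hier_ideal ..
  also have "(\<Sum>a\<in>carrier_vec m. ?h ((v @\<^sub>v w) \<bullet> (a @\<^sub>v 0\<^sub>v r))) = bias v c (carrier_vec m)"
    unfolding bias_def using w by (intro sum.cong) (simp_all add: prod)
  also have "(\<Sum>a\<in>?E. \<Sum>b\<in>nonzero_vecs r. ?h ((v @\<^sub>v w) \<bullet> (a @\<^sub>v b)))
      = (\<Sum>a\<in>?E. (int CARD('a) ^ r * of_bool (w = 0\<^sub>v r) - 1) * ?h (v \<bullet> a))"
  proof (rule sum.cong)
    fix a assume "a \<in> ?E"
    then have a: "a \<in> carrier_vec m" by (rule vecs_over_carrier)
    have "(\<Sum>b\<in>nonzero_vecs r. ?h ((v @\<^sub>v w) \<bullet> (a @\<^sub>v b)))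
        = (\<Sum>b\<in>nonzero_vecs r. ?h (v \<bullet> a + w \<bullet> b))"
      by (rule sum.cong) (simp_all add: prod a nonzero_vecs_def)
    also have "\<dots> = (\<Sum>b\<in>carrier_vec r. ?h (v \<bullet> a + w \<bullet> b)) - ?h (v \<bullet> a)"
      using w by (simp add: nonzero_vecs_def sum_diff1 finite_carrier_vec)
    finally show "(\<Sum>b\<in>nonzero_vecs r. ?h ((v @\<^sub>v w) \<bullet> (a @\<^sub>v b)))
        = (int CARD('a) ^ r * of_bool (w = 0\<^sub>v r) - 1) * ?h (v \<bullet> a)"
      unfolding bias_indep[OF w] by (simp add: algebra_simps)
  qed simp
  also have "\<dots> = (int CARD('a) ^ r * of_bool (w = 0\<^sub>v r) - 1) * bias v c ?E"
    by (simp add: bias_def sum_distrib_left)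
  finally show ?thesis
    using v c by (simp add: bias_carrier_vec bias_nowhere_zero mult_ac)
qed

section \<open>Weights of the codewords\<close>

lemma wt_codeword_linear:
  fixes u :: "'a::{finite,field} vec"
  assumes u: "u \<in> carrier_vec n" "u \<noteq> 0\<^sub>v n"
  shows "int (wt (codeword n f 0 u)) = (int CARD('a) - 1) * int CARD('a) ^ (n - 1)"
proof -
  have "n \<noteq> 0" using u by (auto intro: eq_vecI)
  have "supp (codeword n f 0 u) = carrier_vec n - {x \<in> carrier_vec n. u \<bullet> x = 0}"
    using u by (auto simp: supp_def codeword_def nonzero_vecs_def)
  then have "wt (codeword n f 0 u) = CARD('a) ^ n - CARD('a) ^ (n - 1)"
    by (simp add: wt_def card_Diff_subset finite_carrier_vec card_carrier_vec card_hyperplane[OF u])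
  then show ?thesis using \<open>n \<noteq> 0\<close> by (cases n) (simp_all add: of_nat_diff algebra_simps)
qed

lemma wt_codeword_indicator:
  fixes X :: "'a::{finite,field} vec set"
  assumes X: "X \<subseteq> carrier_vec n" "0\<^sub>v n \<in> X" and s: "s \<noteq> 0"
  shows "int (wt (codeword n (indicator (X - {0\<^sub>v n})) s (0\<^sub>v n))) = int (card X) - 1"
proof -
  have fin: "finite X" using X(1) finite_carrier_vec by (rule finite_subset)
  have "supp (codeword n (indicator (X - {0\<^sub>v n})) s (0\<^sub>v n)) = X - {0\<^sub>v n}"
    using X s by (auto simp: supp_def codeword_def nonzero_vecs_def indicator_def split: if_splits)
  then have "wt (codeword n (indicator (X - {0\<^sub>v n})) s (0\<^sub>v n)) = card X - 1"
    using X fin by (simp add: wt_def)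
  moreover have "card X \<noteq> 0" using X fin by auto
  ultimately show ?thesis by simp
qed

text \<open>
  The codeword \<open>s f(x) + u \<bullet> x\<close> vanishes on the hyperplane \<open>u \<bullet> x = 0\<close> outside the support of \<open>f\<close> and
  on the affine hyperplane \<open>u \<bullet> x = - s\<close> inside it. Hence its weight differs from that of a linear
  functional by the bias of \<open>u\<close> on the support of \<open>f\<close>, which is \<open>X\<close> without the zero vector; the
  removed zero vector accounts for the \<open>- 1\<close>.
\<close>

lemma wt_codeword_bias:
  fixes u :: "'a::{finite,field} vec"
  assumes X: "X \<subseteq> carrier_vec n" "0\<^sub>v n \<in> X"
    and u: "u \<in> carrier_vec n" "u \<noteq> 0\<^sub>v n" and s: "s \<noteq> 0"
  shows "int (wt (codeword n (indicator (X - {0\<^sub>v n})) s u))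
    = (int CARD('a) - 1) * int CARD('a) ^ (n - 1) - 1 + bias u (- s) X"
proof -
  let ?c = "codeword n (indicator (X - {0\<^sub>v n})) s u"
  have fin: "finite X" using X(1) finite_carrier_vec by (rule finite_subset)
  define H where "H = {x \<in> carrier_vec n. u \<bullet> x = 0}"
  define A where "A = {x \<in> X. u \<bullet> x = 0}"
  define B where "B = {x \<in> X. u \<bullet> x = - s}"
  have fins: "finite H" "finite A" "finite B"
    using fin by (simp_all add: H_def A_def B_def finite_carrier_vec)
  have zA: "0\<^sub>v n \<in> A" using X u by (simp add: A_def)
  have n: "n \<noteq> 0" using u by (auto intro: eq_vecI)
  \<comment> \<open>The zero vector is no coordinate; counting it as a zero of the codeword allows the complement
    to be taken in the whole space.\<close>
  have "supp ?c = carrier_vec n - ((H - (A - {0\<^sub>v n})) \<union> B)"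
    using X u s by (auto simp: supp_def codeword_def nonzero_vecs_def indicator_def H_def A_def B_def
        add_eq_0_iff split: if_splits)
  moreover have sub: "(H - (A - {0\<^sub>v n})) \<union> B \<subseteq> carrier_vec n"
    using X by (auto simp: H_def B_def)
  ultimately have "wt ?c = card (carrier_vec n :: 'a vec set) - card ((H - (A - {0\<^sub>v n})) \<union> B)"
    using fins by (simp add: wt_def card_Diff_subset)
  then have 1: "int (wt ?c) = int (card (carrier_vec n :: 'a vec set))
      - int (card ((H - (A - {0\<^sub>v n})) \<union> B))"
    using card_mono[OF finite_carrier_vec sub] by simp
  have "card ((H - (A - {0\<^sub>v n})) \<union> B) = card (H - (A - {0\<^sub>v n})) + card B"
    using fins s by (intro card_Un_disjoint) (auto simp: H_def B_def)
  moreover have "int (card (H - (A - {0\<^sub>v n}))) = int (card H) - int (card (A - {0\<^sub>v n}))"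
    using fins X by (subst card_Diff_subset)
      (auto simp: H_def A_def intro!: of_nat_diff card_mono)
  moreover have "int (card (A - {0\<^sub>v n})) = int (card A) - 1"
  proof -
    have "card A \<ge> 1" using zA fins by (auto simp: Suc_le_eq card_gt_0_iff)
    then show ?thesis using zA by (simp add: of_nat_diff)
  qed
  moreover have "card H = CARD('a) ^ (n - 1)"
    unfolding H_def by (rule card_hyperplane[OF u])
  moreover have "int CARD('a) ^ n = int CARD('a) * int CARD('a) ^ (n - 1)"
    using n by (cases n) auto
  moreover have "bias u (- s) X = int (card A) - int (card B)"
    unfolding A_def B_def by (rule bias_eq_card[OF fin])
  ultimately show ?thesis using 1 by (simp add: card_carrier_vec algebra_simps)
qed

section \<open>Multiplicity vectors of unsaturated order ideals\<close>

lemma CHAR_eq_CARD: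
  assumes "prime p" "CARD('a::{finite,field}) = p"
  shows "CHAR('a) = p"
proof -
  have "CHAR('a) dvd p" using CHAR_dvd_CARD[where 'a = 'a] assms(2) by simp
  moreover have "CHAR('a) \<noteq> 1" by simp
  ultimately show ?thesis using assms(1) by (auto simp: prime_nat_iff)
qed

text \<open>
  A field with a prime number \<open>p\<close> of elements consists of the images of \<open>0, \<dots>, p - 1\<close>, so
  multiplicities below \<open>p\<close> and field elements determine each other.
\<close>

lemma bij_of_nat_field:
  assumes "prime p" "CARD('a::{finite,field}) = p"
  shows "bij_betw (of_nat :: nat \<Rightarrow> 'a) {..<p} UNIV"
proof -
  have inj: "inj_on (of_nat :: nat \<Rightarrow> 'a) {..<p}"
    by (auto simp: inj_on_def of_nat_eq_iff_cong_CHAR CHAR_eq_CARD[OF assms] cong_less_modulus_unique_nat)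
  then have "card ((of_nat :: nat \<Rightarrow> 'a) ` {..<p}) = CARD('a)"
    using assms(2) by (simp add: card_image)
  then have "(of_nat :: nat \<Rightarrow> 'a) ` {..<p} = UNIV"
    by (intro card_subset_eq) auto
  with inj show ?thesis by (simp add: bij_betw_def)
qed

lemma two_neq_zero:
  assumes "prime p" "CARD('a::{finite,field}) = p" "odd p"
  shows "(2 :: 'a) \<noteq> 0"
proof
  assume "(2 :: 'a) = 0"
  then have "of_nat 2 = (0 :: 'a)" by simp
  then have "p dvd 2" unfolding of_nat_eq_0_iff_char_dvd CHAR_eq_CARD[OF assms(1,2)] .
  then have "p \<le> 2" by (rule dvd_imp_le) simp
  with prime_gt_1_nat[OF assms(1)] have "p = 2" by simp
  then show False using assms(3) by simp
qed

lemma hier_ideal_iff_index: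
  assumes "x \<in> carrier_vec (m + r)"
  shows "x \<in> hier_ideal m r \<longleftrightarrow> (\<forall>i\<in>{m..<m + r}. x $ i = 0) \<or> (\<forall>i<m. x $ i \<noteq> 0)"
proof -
  obtain a b where x: "x = a @\<^sub>v b" and a: "a \<in> carrier_vec m" and b: "b \<in> carrier_vec r"
    using append_vec_cases[OF assms] .
  have "b = 0\<^sub>v r \<longleftrightarrow> (\<forall>i\<in>{m..<m + r}. x $ i = 0)"
  proof
    assume z: "\<forall>i\<in>{m..<m + r}. x $ i = 0"
    show "b = 0\<^sub>v r"
    proof (rule eq_vecI)
      fix i assume "i < dim_vec (0\<^sub>v r :: 'a vec)"
      then show "b $ i = 0\<^sub>v r $ i" using bspec[OF z, of "m + i"] x a b by simp
    qed (use b in simp)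
  qed (use x a b in auto)
  moreover have "a \<in> vecs_over (- {0}) m \<longleftrightarrow> (\<forall>i<m. x $ i \<noteq> 0)"
    using x a b by (auto simp: vecs_over_def)
  ultimately show ?thesis using append_mem_hier_ideal[OF a b] x by simp
qed

text \<open>
  A subset of the poset is down-closed iff it lies in the lower level or contains all of it. Since
  \<open>I\<close> has full multiplicities, containment in \<open>I\<close> imposes nothing further, and the multiplicity
  vectors form exactly \<open>hier_ideal m r\<close>.
\<close>

lemma ideal_vecs_eq_hier_ideal:
  assumes p: "prime p" "CARD('a::{finite,field}) = p"
    and I: "\<forall>i\<in>{1..m + r}. count I i = p - 1"
  shows "ideal_vecs p (m + r) (hier_less m (m + r)) I = (hier_ideal m r :: 'a vec set)"
proof (intro equalityI subsetI)
  have p1: "p > 1" using p(1) by (rule prime_gt_1_nat)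
  note bij = bij_of_nat_field[OF p]
  have zero_iff: "of_nat k = (0 :: 'a) \<longleftrightarrow> k = 0" if "k \<le> p - 1" for k
    using inj_onD[OF bij_betw_imp_inj_on[OF bij], of k 0] that p1 by auto
  fix x :: "'a vec"
  {
    assume "x \<in> ideal_vecs p (m + r) (hier_less m (m + r)) I"
    then obtain J where x: "x = mult_vec (m + r) J"
      and J: "J \<subseteq># repeat_mset (p - 1) (mset_set {1..m + r})"
      and ord: "order_ideal (m + r) (hier_less m (m + r)) (set_mset J)"
      by (auto simp: ideal_vecs_def unsat_ideal_def)
    have xc: "x \<in> carrier_vec (m + r)" by (simp add: x mult_vec_def)
    have idx: "x $ i = 0 \<longleftrightarrow> Suc i \<notin># J" if "i < m + r" for i
    proof -
      have "count J (Suc i) \<le> p - 1"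
        using mset_subset_eq_count[OF J, of "Suc i"] that by simp
      then show ?thesis
        using that by (simp add: x mult_vec_def zero_iff count_eq_zero_iff)
    qed
    show "x \<in> hier_ideal m r"
    proof (cases "\<forall>i\<in>{m..<m + r}. x $ i = 0")
      case False
      then obtain j where j: "j \<in> {m..<m + r}" "Suc j \<in># J" using idx by auto
      have "x $ i \<noteq> 0" if "i < m" for i
      proof -
        have "hier_less m (m + r) (Suc i) (Suc j)" using that j by (auto simp: hier_less_def)
        then have "Suc i \<in># J" using ord j that by (auto simp: order_ideal_def)
        then show ?thesis using idx[of i] that by simp
      qed
      then show ?thesis using xc by (simp add: hier_ideal_iff_index)
    qed (simp add: hier_ideal_iff_index[OF xc])
  next
    assume xI: "x \<in> hier_ideal m r"
    then have xc: "x \<in> carrier_vec (m + r)" using hier_ideal_subset_carrier by blast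
    \<comment> \<open>\<open>g\<close> lifts a field element to its representative below \<open>p\<close>.\<close>
    define g where "g = the_inv_into {..<p} (of_nat :: nat \<Rightarrow> 'a)"
    have g: "of_nat (g t) = t" "g t \<le> p - 1" for t
    proof -
      show "of_nat (g t) = t"
        unfolding g_def using bij by (intro f_the_inv_into_f_bij_betw) auto
      have "g t \<in> {..<p}"
        unfolding g_def using bij
        by (intro the_inv_into_into) (auto simp: bij_betw_def)
      then show "g t \<le> p - 1" by simp
    qed
    have g0: "g t = 0 \<longleftrightarrow> t = 0" for t using zero_iff[OF g(2)] g(1) by metis
    define J where "J = (\<Sum>i<m + r. replicate_mset (g (x $ i)) (Suc i))"
    have cnt: "count J k = (if k \<in> {1..m + r} then g (x $ (k - 1)) else 0)" for k
    proof -
      have "count J k = (\<Sum>i<m + r. if k = Suc i then g (x $ i) else 0)"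
        unfolding J_def by (simp add: count_sum)
      also have "\<dots> = (\<Sum>i<m + r. if i = k - 1 \<and> k \<noteq> 0 then g (x $ i) else 0)"
        by (intro sum.cong) auto
      also have "\<dots> = (if k \<in> {1..m + r} then g (x $ (k - 1)) else 0)"
        by (cases k) (auto simp: sum.delta)
      finally show ?thesis .
    qed
    have mem: "k \<in># J \<longleftrightarrow> k \<in> {1..m + r} \<and> x $ (k - 1) \<noteq> 0" for k
      by (auto simp: count_greater_zero_iff[symmetric] cnt g0[symmetric]
          simp del: count_greater_zero_iff)
    have "x = mult_vec (m + r) J"
      using xc by (intro eq_vecI) (auto simp: mult_vec_def cnt g(1))
    moreover have "J \<subseteq># repeat_mset (p - 1) (mset_set {1..m + r})"
      by (rule mset_subset_eqI) (use g(2) in \<open>auto simp: cnt\<close>)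
    moreover have "J \<subseteq># I"
      by (rule mset_subset_eqI) (use I g(2) in \<open>auto simp: cnt\<close>)
    moreover have "order_ideal (m + r) (hier_less m (m + r)) (set_mset J)"
      unfolding order_ideal_def
    proof (intro conjI ballI impI)
      fix j i assume j: "j \<in># J" and i: "hier_less m (m + r) i j"
      then have "j - 1 \<in> {m..<m + r}" "x $ (j - 1) \<noteq> 0" by (auto simp: mem hier_less_def)
      then have "\<forall>i<m. x $ i \<noteq> 0" using xI unfolding hier_ideal_iff_index[OF xc] by blast
      then show "i \<in># J" using i by (auto simp: mem hier_less_def)
    qed (auto simp: mem)
    ultimately show "x \<in> ideal_vecs p (m + r) (hier_less m (m + r)) I"
      by (auto simp: ideal_vecs_def unsat_ideal_def)
  }
qed

section \<open>Dimension of the code of a function\<close>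

lemma codeword_smult:
  assumes "u \<in> carrier_vec n"
  shows "(\<lambda>x. a * codeword n f s u x) = codeword n f (a * s) (a \<cdot>\<^sub>v u)"
  using assms by (auto simp: codeword_def fun_eq_iff nonzero_vecs_def algebra_simps)

lemma codeword_0: "codeword n f 0 (0\<^sub>v n) = 0"
  by (auto simp: codeword_def fun_eq_iff nonzero_vecs_def)

lemma sum_fun_apply: "(\<Sum>i\<in>A. g i) x = (\<Sum>i\<in>A. (g i x :: 'b::comm_monoid_add))"
  by (induction A rule: infinite_finite_induct) auto

text \<open>
  The parameters \<open>(u, s)\<close> are encoded as one function on \<open>{..n}\<close>: the entries of \<open>u\<close> come first and
  \<open>s\<close> is the value at \<open>n\<close>.
\<close>

lemma code_of_eq: "code_of n f = range (\<lambda>a. codeword n f (a n) (vec n a))"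
proof (intro equalityI subsetI)
  fix c assume "c \<in> code_of n f"
  then obtain s u where c: "c = codeword n f s u" and u: "u \<in> carrier_vec n"
    by (auto simp: code_of_def)
  have "vec n (\<lambda>i. if i < n then u $ i else s) = u"
    using u by (intro eq_vecI) auto
  then show "c \<in> range (\<lambda>a. codeword n f (a n) (vec n a))"
    unfolding c by (intro range_eqI[of _ _ "\<lambda>i. if i < n then u $ i else s"]) simp
next
  fix c assume "c \<in> range (\<lambda>a. codeword n f (a n) (vec n a))"
  then show "c \<in> code_of n f" unfolding code_of_def using vec_carrier by blast
qed

text \<open>
  If the parametrization of the codewords by \<open>(s, u)\<close> is injective, then the \<open>n\<close> coordinate functions
  together with the codeword of \<open>f\<close> itself form a basis.
\<close>

lemma dim_code_of:
  fixes f :: "'a::field vec \<Rightarrow> 'a"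
  assumes inj: "\<And>s u. u \<in> carrier_vec n \<Longrightarrow> codeword n f s u = 0 \<Longrightarrow> s = 0 \<and> u = 0\<^sub>v n"
  shows "word_space.subspace (code_of n f)" "word_space.dim (code_of n f) = n + 1"
proof -
  define b where
    "b i = codeword n f (if i < n then 0 else 1) (if i < n then unit_vec n i else 0\<^sub>v n)" for i
  have comb: "(\<Sum>i\<le>n. (\<lambda>x. a i * b i x)) = codeword n f (a n) (vec n a)" for a
  proof
    fix x :: "'a vec"
    have "(\<Sum>i<n. a i * (unit_vec n i \<bullet> x)) = vec n a \<bullet> x" if "x \<in> carrier_vec n"
      using that by (auto simp: scalar_prod_def[of "vec n a"] atLeast0LessThan intro!: sum.cong)
    then show "(\<Sum>i\<le>n. (\<lambda>x. a i * b i x)) x = codeword n f (a n) (vec n a) x"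
      by (auto simp: sum_fun_apply b_def codeword_def nonzero_vecs_def lessThan_Suc_atMost[symmetric])
  qed
  have zero: "a i = 0" if "(\<Sum>i\<le>n. (\<lambda>x. a i * b i x)) = 0" "i \<le> n" for a i
  proof -
    have *: "a n = 0 \<and> vec n a = 0\<^sub>v n"
      using that(1) unfolding comb by (intro inj) auto
    then have "vec n a $ i = 0\<^sub>v n $ i" by simp
    then show ?thesis using conjunct1[OF *] that(2) by (cases "i = n") auto
  qed
  have inj_b: "inj_on b {..n}"
  proof (rule inj_onI, rule ccontr)
    fix i j assume ij: "i \<in> {..n}" "j \<in> {..n}" "b i = b j" "i \<noteq> j"
    define a :: "nat \<Rightarrow> 'a" where "a k = (if k = i then 1 else if k = j then - 1 else 0)" for k
    have "(\<Sum>k\<le>n. (\<lambda>x. a k * b k x)) = (\<Sum>k\<in>{i, j}. (\<lambda>x. a k * b k x))"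
      using ij by (intro sum.mono_neutral_right) (auto simp: a_def fun_eq_iff)
    also have "\<dots> = 0" using ij by (simp add: a_def fun_eq_iff)
    finally have "a i = 0" using ij by (intro zero) auto
    then show False by (simp add: a_def)
  qed
  have reindex: "(\<Sum>c\<in>b ` {..n}. (\<lambda>x. g c * c x)) = (\<Sum>i\<le>n. (\<lambda>x. g (b i) * b i x))" for g
    by (simp add: sum.reindex[OF inj_b])
  have indep: "word_space.independent (b ` {..n})"
  proof (rule word_space.independent_if_scalars_zero)
    fix g c assume "(\<Sum>c\<in>b ` {..n}. (\<lambda>x. g c * c x)) = 0" "c \<in> b ` {..n}"
    then show "g c = 0" using zero[of "\<lambda>i. g (b i)"] unfolding reindex by auto
  qed simp
  have span: "word_space.span (b ` {..n}) = code_of n f"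
  proof -
    \<comment> \<open>A span ranges over coefficients attached to the vectors of the basis; injectivity of \<open>b\<close>
      turns coefficients attached to indices into such.\<close>
    have "codeword n f (a n) (vec n a) \<in> range (\<lambda>g. codeword n f (g (b n)) (vec n (\<lambda>i. g (b i))))"
      for a
    proof -
      let ?g = "\<lambda>c. a (the_inv_into {..n} b c)"
      have "?g (b i) = a i" if "i \<le> n" for i
        using that by (simp add: the_inv_into_f_f[OF inj_b])
      then have "codeword n f (a n) (vec n a) = codeword n f (?g (b n)) (vec n (\<lambda>i. ?g (b i)))"
        by (intro arg_cong2[where f = "codeword n f"] eq_vecI) auto
      then show ?thesis by (rule range_eqI[where x = ?g])
    qed
    then show ?thesis
      unfolding word_space.span_finite[OF finite_imageI[OF finite_atMost]] reindex comb code_of_eq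
      by auto
  qed
  show "word_space.subspace (code_of n f)"
    unfolding span[symmetric] by (rule word_space.subspace_span)
  show "word_space.dim (code_of n f) = n + 1"
    unfolding span[symmetric] word_space.dim_span_eq_card_independent[OF indep]
    by (simp add: card_image[OF inj_b])
qed

section \<open>Zeros of the codewords and minimality\<close>

text \<open>
  The characteristic function of the ideal without the zero vector.
\<close>

abbreviation hier_fun :: "nat \<Rightarrow> nat \<Rightarrow> 'a::{finite,field} vec \<Rightarrow> 'a" where
  "hier_fun m r \<equiv> indicator (hier_ideal m r - {0\<^sub>v (m + r)})"

lemma hier_fun_append:
  assumes "a \<in> carrier_vec m" "b \<in> carrier_vec r"
  shows "hier_fun m r (a @\<^sub>v b)
    = of_bool ((b = 0\<^sub>v r \<or> a \<in> vecs_over (- {0}) m) \<and> (a \<noteq> 0\<^sub>v m \<or> b \<noteq> 0\<^sub>v r))"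
  using append_mem_hier_ideal[OF assms] append_eq_zero_iff[OF assms(1)]
  by (simp add: indicator_def)

lemma append_mem_nonzero_vecs:
  assumes "a \<in> carrier_vec m" "b \<in> carrier_vec r"
  shows "a @\<^sub>v b \<in> nonzero_vecs (m + r) \<longleftrightarrow> a \<noteq> 0\<^sub>v m \<or> b \<noteq> 0\<^sub>v r"
  using append_eq_zero_iff[OF assms(1)] assms by (simp add: nonzero_vecs_def)

lemma smult_unit_not_nowhere_zero:
  assumes "m \<ge> 2" "i < m"
  shows "c \<cdot>\<^sub>v unit_vec m i \<notin> vecs_over (- {0 :: 'a::field}) m"
proof -
  define j where "j = (if i = 0 then 1 else 0 :: nat)"
  have "j < m" "j \<noteq> i" using assms by (auto simp: j_def)
  then show ?thesis using assms(2) by (auto simp: vecs_over_def intro!: exI[of _ j])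
qed

text \<open>
  The zeros of a codeword \<open>c(s, u)\<close> with \<open>s \<noteq> 0\<close> span the whole space: a functional \<open>y\<close> that
  vanishes on all of them is 0. Let \<open>u = (v, w)\<close>. Writing points as \<open>(a, b)\<close>, the zeros are of three
  kinds: \<open>(a, 0)\<close> with \<open>v \<bullet> a = - s\<close>; \<open>(a, b)\<close> with \<open>b \<noteq> 0\<close>, \<open>a\<close> without a zero entry and
  \<open>u \<bullet> (a, b) = - s\<close>; \<open>(a, b)\<close> with \<open>b \<noteq> 0\<close>, \<open>a\<close> with a zero entry and \<open>u \<bullet> (a, b) = 0\<close>.
  If \<open>v \<noteq> 0\<close>, the first kind and the third suffice; if \<open>v = 0\<close> and \<open>w \<noteq> 0\<close>, the second kind does;
  if \<open>u = 0\<close>, the third does.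
\<close>

lemma zeros_span:
  fixes u y :: "'a::{finite,field} vec"
  assumes m: "m \<ge> 2" and r: "r \<ge> 1" and two: "(2 :: 'a) \<noteq> 0" and s: "s \<noteq> 0"
    and u: "u \<in> carrier_vec (m + r)" and y: "y \<in> carrier_vec (m + r)"
    and van: "\<And>x. x \<in> nonzero_vecs (m + r) \<Longrightarrow> s * hier_fun m r x + u \<bullet> x = 0 \<Longrightarrow> y \<bullet> x = 0"
  shows "y = 0\<^sub>v (m + r)"
proof -
  obtain v w where u_eq: "u = v @\<^sub>v w" and v: "v \<in> carrier_vec m" and w: "w \<in> carrier_vec r"
    using append_vec_cases[OF u] .
  obtain y1 y2 where y_eq: "y = y1 @\<^sub>v y2" and y1: "y1 \<in> carrier_vec m" and y2: "y2 \<in> carrier_vec r"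
    using append_vec_cases[OF y] .
  let ?E = "vecs_over (- {0}) m :: 'a vec set"
  have van': "y1 \<bullet> a + y2 \<bullet> b = 0"
    if "a \<in> carrier_vec m" "b \<in> carrier_vec r" "a \<noteq> 0\<^sub>v m \<or> b \<noteq> 0\<^sub>v r"
      "s * of_bool (b = 0\<^sub>v r \<or> a \<in> ?E) + (v \<bullet> a + w \<bullet> b) = 0" for a b
    using van[of "a @\<^sub>v b"] that
    by (simp add: append_mem_nonzero_vecs hier_fun_append u_eq y_eq
        scalar_prod_append[OF v w] scalar_prod_append[OF y1 y2])
  have "y1 = 0\<^sub>v m \<and> y2 = 0\<^sub>v r"
  proof (cases "v = 0\<^sub>v m")
    case False
    have y1_0: "y1 = 0\<^sub>v m"
    proof (rule vanishing_on_affine_hyperplane[OF v False _ y1])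
      show "- s \<noteq> 0" using s by simp
      fix a :: "'a vec" assume a: "a \<in> carrier_vec m" "v \<bullet> a = - s"
      then have "a \<noteq> 0\<^sub>v m" using s v by auto
      then show "y1 \<bullet> a = 0" using van'[of a "0\<^sub>v r"] a w y2 by simp
    qed
    have "y2 = 0\<^sub>v r"
    proof (rule scalar_prod_nondegenerate[OF y2])
      fix b :: "'a vec" assume b: "b \<in> carrier_vec r"
      obtain i where i: "i < m" "v $ i \<noteq> 0"
        using v False by (metis carrier_vecD eq_vecI index_zero_vec)
      \<comment> \<open>A multiple of a unit vector has a zero entry because \<open>m \<ge> 2\<close>, so \<open>f\<close> vanishes at
        \<open>(a, b)\<close>; the factor is chosen such that \<open>v \<bullet> a + w \<bullet> b = 0\<close>.\<close>
      define a where "a = (- (w \<bullet> b) / v $ i) \<cdot>\<^sub>v unit_vec m i"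
      have a: "a \<in> carrier_vec m" by (simp add: a_def)
      have "v \<bullet> a = - (w \<bullet> b)"
        unfolding a_def using v i by (subst scalar_prod_smult_distrib[of _ m]) auto
      moreover have "a \<notin> ?E" unfolding a_def using m i(1) by (rule smult_unit_not_nowhere_zero)
      ultimately show "y2 \<bullet> b = 0"
        using van'[OF a b] a b y1_0 y2 by (cases "b = 0\<^sub>v r") auto
    qed
    with y1_0 show ?thesis ..
  next
    case v0: True
    show ?thesis
    proof (cases "w = 0\<^sub>v r")
      case False
      define one where "one = vec m (\<lambda>_. 1 :: 'a)"
      have one: "one \<in> ?E" "one \<in> carrier_vec m" by (auto simp: one_def vecs_over_def)
      have vanE: "y1 \<bullet> a + y2 \<bullet> b = 0"
        if a: "a \<in> ?E" and b: "b \<in> carrier_vec r" "w \<bullet> b = - s" for a b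
      proof -
        have "b \<noteq> 0\<^sub>v r" using b(2) s w by auto
        then show ?thesis using van'[of a b] a b v0 vecs_over_carrier[OF a] by simp
      qed
      have y1_0: "y1 = 0\<^sub>v m"
      proof (rule eq_vecI)
        fix i assume "i < dim_vec (0\<^sub>v m :: 'a vec)"
        then have i: "i < m" by simp
        obtain b where b: "b \<in> carrier_vec r" "w \<bullet> b = - s"
          using exists_scalar_prod_eq[OF w False] .
        \<comment> \<open>Changing one entry from 1 to 2, which is again nonzero, isolates the entry of \<open>y1\<close>.\<close>
        have "(one + unit_vec m i) $ j \<noteq> 0" if "j < m" for j
          using two that i by (cases "j = i") (simp_all add: one_def)
        then have "one + unit_vec m i \<in> ?E" by (simp add: one_def vecs_over_def)
        from vanE[OF this b] have "(y1 \<bullet> one + y2 \<bullet> b) + y1 $ i = 0"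
          using y1 one i by (simp add: scalar_prod_add_distrib[of _ m] algebra_simps)
        with vanE[OF one(1) b] show "y1 $ i = 0\<^sub>v m $ i" using i by simp
      qed (use y1 in simp)
      have "y2 = 0\<^sub>v r"
      proof (rule vanishing_on_affine_hyperplane[OF w False _ y2])
        show "- s \<noteq> 0" using s by simp
        fix b :: "'a vec" assume b: "b \<in> carrier_vec r" "w \<bullet> b = - s"
        show "y2 \<bullet> b = 0" using vanE[OF one(1) b] y1_0 one by simp
      qed
      with y1_0 show ?thesis ..
    next
      case w0: True
      have van0: "y1 \<bullet> a + y2 \<bullet> b = 0"
        if "a \<in> carrier_vec m" "a \<notin> ?E" "b \<in> carrier_vec r" "b \<noteq> 0\<^sub>v r" for a b
        using van'[of a b] that v0 w0 by simp
      have not_E: "0\<^sub>v m \<notin> ?E" using m by (auto simp: vecs_over_def intro!: exI[of _ 0])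
      have y2_0: "y2 = 0\<^sub>v r"
      proof (rule scalar_prod_nondegenerate[OF y2])
        fix b :: "'a vec" assume b: "b \<in> carrier_vec r"
        then show "y2 \<bullet> b = 0"
          using van0[of "0\<^sub>v m" b] not_E y1 y2 by (cases "b = 0\<^sub>v r") auto
      qed
      have "unit_vec r 0 $ 0 \<noteq> (0\<^sub>v r $ 0 :: 'a)" using r by simp
      then have b: "unit_vec r 0 \<noteq> (0\<^sub>v r :: 'a vec)" by metis
      have "y1 = 0\<^sub>v m"
      proof (rule eq_vecI)
        fix i assume "i < dim_vec (0\<^sub>v m :: 'a vec)"
        then have i: "i < m" by simp
        have "unit_vec m i \<notin> ?E" using smult_unit_not_nowhere_zero[OF m i, of 1] by simp
        then show "y1 $ i = 0\<^sub>v m $ i"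
          using van0[OF _ _ _ b, of "unit_vec m i"] i y1 y2_0 by simp
      qed (use y1 in simp)
      then show ?thesis using y2_0 ..
    qed
  qed
  then show ?thesis using append_eq_zero_iff[OF y1] y_eq by simp
qed

text \<open>
  A codeword that vanishes wherever the functional \<open>u\<close> does has no component along \<open>f\<close>. Since
  \<open>m \<ge> 2\<close>, the kernel of \<open>u\<close> contains some \<open>(a, 0)\<close> with \<open>a \<noteq> 0\<close>. At this point and at its negative
  \<open>f\<close> takes the value 1 while linear functionals change sign; adding the two equations gives
  \<open>2 s' = 0\<close>.
\<close>

lemma no_ideal_coefficient:
  fixes u u' :: "'a::{finite,field} vec"
  assumes m: "m \<ge> 2" and two: "(2 :: 'a) \<noteq> 0"
    and u: "u \<in> carrier_vec (m + r)" and u': "u' \<in> carrier_vec (m + r)"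
    and van: "\<And>x. x \<in> nonzero_vecs (m + r) \<Longrightarrow> u \<bullet> x = 0 \<Longrightarrow> s' * hier_fun m r x + u' \<bullet> x = 0"
  shows "s' = 0"
proof -
  obtain v w where u_eq: "u = v @\<^sub>v w" and v: "v \<in> carrier_vec m" and w: "w \<in> carrier_vec r"
    using append_vec_cases[OF u] .
  obtain v' w' where u'_eq: "u' = v' @\<^sub>v w'" and v': "v' \<in> carrier_vec m" and w': "w' \<in> carrier_vec r"
    using append_vec_cases[OF u'] .
  obtain a where a: "a \<in> carrier_vec m" "v \<bullet> a = 0" "a \<noteq> 0\<^sub>v m"
  proof (cases "v $ 0 = 0")
    case True
    have "unit_vec m 0 $ 0 \<noteq> (0\<^sub>v m $ 0 :: 'a)" using m by simp
    then have "unit_vec m 0 \<noteq> (0\<^sub>v m :: 'a vec)" by metis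
    then show thesis using that[of "unit_vec m 0"] True m v by simp
  next
    case False
    define a where "a = v $ 1 \<cdot>\<^sub>v unit_vec m 0 - v $ 0 \<cdot>\<^sub>v unit_vec m 1"
    have "a $ 1 \<noteq> 0\<^sub>v m $ 1" using False m by (simp add: a_def)
    then have "a \<noteq> 0\<^sub>v m" by metis
    moreover have "v \<bullet> a = 0"
      using v m by (simp add: a_def scalar_prod_minus_distrib[of _ m] scalar_prod_smult_distrib[of _ m])
    ultimately show thesis using that[of a] by (simp add: a_def)
  qed
  have van': "s' + v' \<bullet> b = 0" if b: "b \<in> carrier_vec m" "v \<bullet> b = 0" "b \<noteq> 0\<^sub>v m" for b
    using van[of "b @\<^sub>v 0\<^sub>v r"] b w w'
    by (simp add: append_mem_nonzero_vecs hier_fun_append u_eq u'_eq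
        scalar_prod_append[OF v w] scalar_prod_append[OF v' w'])
  have "s' + v' \<bullet> a = 0" using a by (rule van')
  moreover have "s' + v' \<bullet> (- a) = 0"
  proof (rule van')
    show "- a \<noteq> 0\<^sub>v m"
    proof
      assume "- a = 0\<^sub>v m"
      then have "- (- a) = - 0\<^sub>v m" by simp
      then show False using a by simp
    qed
  qed (use a v in auto)
  ultimately have "2 * s' = 0" using a v' by (simp add: algebra_simps add_eq_0_iff)
  then show ?thesis using two by simp
qed

lemma codeword_eq_0:
  fixes u :: "'a::{finite,field} vec"
  assumes m: "m \<ge> 2" and two: "(2 :: 'a) \<noteq> 0" and u: "u \<in> carrier_vec (m + r)"
    and z: "codeword (m + r) (hier_fun m r) s u = 0"
  shows "s = 0 \<and> u = 0\<^sub>v (m + r)"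
proof -
  have van: "s * hier_fun m r x + u \<bullet> x = 0" if "x \<in> nonzero_vecs (m + r)" for x
    using fun_cong[OF z, of x] that by (simp add: codeword_def)
  then have s: "s = 0" using no_ideal_coefficient[OF m two u u] by blast
  have "u = 0\<^sub>v (m + r)"
  proof (rule scalar_prod_nondegenerate[OF u])
    fix x :: "'a vec" assume "x \<in> carrier_vec (m + r)"
    then show "u \<bullet> x = 0"
      using van[of x] s u by (cases "x = 0\<^sub>v (m + r)") (auto simp: nonzero_vecs_def)
  qed
  with s show ?thesis ..
qed

text \<open>
  Let the support of \<open>c' = c(s', u')\<close> lie in that of \<open>c = c(s, u)\<close>. If \<open>s = 0\<close>, then \<open>s' = 0\<close> and
  \<open>u'\<close> vanishes on the kernel of \<open>u\<close>, so it is a multiple of \<open>u\<close>. If \<open>s \<noteq> 0\<close>,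
  then \<open>c' - (s' / s) c\<close> is a linear functional that vanishes on the zeros of \<open>c\<close>, hence is 0.
\<close>

lemma minimal_code_hier:
  assumes m: "m \<ge> 2" and r: "r \<ge> 1" and two: "(2 :: 'a::{finite,field}) \<noteq> 0"
  shows "minimal_code (code_of (m + r) (hier_fun m r :: 'a vec \<Rightarrow> 'a))"
  unfolding minimal_code_def minimal_codeword_def
proof (intro ballI impI conjI)
  let ?n = "m + r"
  let ?f = "hier_fun m r :: 'a vec \<Rightarrow> 'a"
  fix c c'
  assume "c \<in> code_of ?n ?f" "c \<noteq> 0" "c' \<in> code_of ?n ?f" and sub: "supp c' \<subseteq> supp c"
  then obtain s u s' u' where c: "c = codeword ?n ?f s u" and u: "u \<in> carrier_vec ?n"
    and c': "c' = codeword ?n ?f s' u'" and u': "u' \<in> carrier_vec ?n"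
    by (auto simp: code_of_def)
  have van: "s' * ?f x + u' \<bullet> x = 0"
    if "x \<in> nonzero_vecs ?n" "s * ?f x + u \<bullet> x = 0" for x
    using subsetD[OF sub, of x] that by (auto simp: supp_def c c' codeword_def)
  have "\<exists>a. s' = a * s \<and> u' = a \<cdot>\<^sub>v u"
  proof (cases "s = 0")
    case True
    then have "u \<noteq> 0\<^sub>v ?n" using \<open>c \<noteq> 0\<close> codeword_0 c by metis
    have s': "s' = 0"
      using no_ideal_coefficient[OF m two u u', of s'] van True by simp
    have "\<exists>a. u' = a \<cdot>\<^sub>v u"
    proof (rule vanishing_on_hyperplane[OF u \<open>u \<noteq> 0\<^sub>v ?n\<close> u'])
      fix x assume "x \<in> carrier_vec ?n" "u \<bullet> x = 0"
      then show "u' \<bullet> x = 0"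
        using van[of x] True s' u' by (cases "x = 0\<^sub>v ?n") (auto simp: nonzero_vecs_def)
    qed
    then show ?thesis using True s' by simp
  next
    case False
    define a where "a = s' / s"
    have s': "s' = a * s" using False by (simp add: a_def)
    have "u' - a \<cdot>\<^sub>v u = 0\<^sub>v ?n"
    proof (rule zeros_span[OF m r two False u])
      fix x assume x: "x \<in> nonzero_vecs ?n" and z: "s * ?f x + u \<bullet> x = 0"
      then have xc: "x \<in> carrier_vec ?n" by (simp add: nonzero_vecs_def)
      have "(u' - a \<cdot>\<^sub>v u) \<bullet> x = (s' * ?f x + u' \<bullet> x) - a * (s * ?f x + u \<bullet> x)"
        using xc u u' by (simp add: minus_scalar_prod_distrib[of _ ?n] s' algebra_simps)
      then show "(u' - a \<cdot>\<^sub>v u) \<bullet> x = 0" using van[OF x z] z by simp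
    qed (use u u' in simp)
    then have "u' $ i = a * u $ i" if "i < ?n" for i
      using that u u' by (auto simp: vec_eq_iff)
    then have "u' = a \<cdot>\<^sub>v u" using u u' by (intro eq_vecI) auto
    then show ?thesis using s' by blast
  qed
  then show "\<exists>a. c' = (\<lambda>x. a * c x)"
    using codeword_smult[OF u, of _ ?f s] by (auto simp: c c')
qed

section \<open>Parameters, minimality and weights\<close>

theorem theorem5p7:
  fixes p n m r :: nat
    and I :: "nat multiset"
    and IGP :: "'a::{finite,field} vec set"
    and f :: "'a vec \<Rightarrow> 'a"
    and Q :: int
  assumes "prime p" "odd p" "CARD('a) = p"
    and "n \<ge> 3" "2 \<le> m" "m \<le> n - 1" "r = n - m"
    and "unsat_ideal p n (hier_less m n) I"
    and "\<forall>i\<in>{1..n}. count I i = p - 1"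
    and "IGP = ideal_vecs p n (hier_less m n) I"
    and "f = indicator (IGP - {0\<^sub>v n})"
    and "Q = (int p - 1) * int p ^ (n - 1)"
  shows "linear_code (nonzero_vecs n) (p ^ n - 1) (n + 1) (code_of n f)
    \<and> minimal_code (code_of n f)
    \<and> (\<forall>u\<in>carrier_vec n. u \<noteq> 0\<^sub>v n \<longrightarrow> int (wt (codeword n f 0 u)) = Q)
    \<and> (\<forall>s. s \<noteq> 0 \<longrightarrow> int (wt (codeword n f s (0\<^sub>v n))) = int (card IGP) - 1)
    \<and> int (card IGP) - 1 = int p ^ m + (int p - 1) ^ m * (int p ^ r - 1) - 1
    \<and> (\<forall>s. \<forall>v\<in>carrier_vec m. \<forall>w\<in>carrier_vec r. s \<noteq> 0 \<longrightarrow> v @\<^sub>v w \<noteq> 0\<^sub>v n \<longrightarrow>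
         int (wt (codeword n f s (v @\<^sub>v w))) =
           Q - 1 + int p ^ m * of_bool (v = 0\<^sub>v m)
             + (-1) ^ wt_vec v * (int p - 1) ^ (m - wt_vec v)
               * (int p ^ r * of_bool (w = 0\<^sub>v r) - 1))"
proof -
  have n: "n = m + r" and r: "r \<ge> 1" using assms(4-7) by auto
  have IGP: "IGP = hier_ideal m r"
    using ideal_vecs_eq_hier_ideal[OF assms(1,3)] assms(9,10) by (simp add: n)
  have f: "f = hier_fun m r" using assms(11) by (simp add: IGP n)
  have two: "(2 :: 'a) \<noteq> 0" using two_neq_zero[OF assms(1,3,2)] .
  note X = hier_ideal_subset_carrier[of m r, where 'a = 'a]
    zero_mem_hier_ideal[of m r, where 'a = 'a]
  have "linear_code (nonzero_vecs n) (p ^ n - 1) (n + 1) (code_of n f)"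
    unfolding linear_code_def
  proof (intro conjI)
    show "word_space.subspace (code_of n f)" "word_space.dim (code_of n f) = n + 1"
      using codeword_eq_0[OF assms(5) two] unfolding f n by (intro dim_code_of; blast)+
    show "\<forall>c\<in>code_of n f. supp c \<subseteq> nonzero_vecs n"
      by (auto simp: code_of_def supp_def codeword_def split: if_splits)
  qed (simp_all add: finite_nonzero_vecs card_nonzero_vecs assms(3))
  moreover have "minimal_code (code_of n f)"
    unfolding f n by (rule minimal_code_hier[OF assms(5) r two])
  moreover have "\<forall>u\<in>carrier_vec n. u \<noteq> 0\<^sub>v n \<longrightarrow> int (wt (codeword n f 0 u)) = Q"
    using wt_codeword_linear[of _ n f] by (simp add: assms(3,12))
  moreover have "\<forall>s. s \<noteq> 0 \<longrightarrow> int (wt (codeword n f s (0\<^sub>v n))) = int (card IGP) - 1"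
    using wt_codeword_indicator[OF X] by (simp add: f n IGP)
  moreover have "int (card IGP) - 1 = int p ^ m + (int p - 1) ^ m * (int p ^ r - 1) - 1"
    by (simp add: IGP card_hier_ideal assms(3))
  moreover have "\<forall>s. \<forall>v\<in>carrier_vec m. \<forall>w\<in>carrier_vec r. s \<noteq> 0 \<longrightarrow> v @\<^sub>v w \<noteq> 0\<^sub>v n \<longrightarrow>
         int (wt (codeword n f s (v @\<^sub>v w))) =
           Q - 1 + int p ^ m * of_bool (v = 0\<^sub>v m)
             + (-1) ^ wt_vec v * (int p - 1) ^ (m - wt_vec v)
               * (int p ^ r * of_bool (w = 0\<^sub>v r) - 1)"
  proof (intro allI ballI impI)
    fix s :: 'a and v w :: "'a vec"
    assume vw: "v \<in> carrier_vec m" "w \<in> carrier_vec r" and s: "s \<noteq> 0" and nz: "v @\<^sub>v w \<noteq> 0\<^sub>v n"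
    have "int (wt (codeword n f s (v @\<^sub>v w))) = Q - 1 + bias (v @\<^sub>v w) (- s) (hier_ideal m r)"
      using wt_codeword_bias[OF X, of "v @\<^sub>v w" s] vw s nz by (simp add: f n assms(3,12))
    also have "bias (v @\<^sub>v w) (- s) (hier_ideal m r) = int p ^ m * of_bool (v = 0\<^sub>v m)
        + (- 1) ^ wt_vec v * (int p - 1) ^ (m - wt_vec v) * (int p ^ r * of_bool (w = 0\<^sub>v r) - 1)"
      using bias_hier_ideal[OF vw, of "- s"] s by (simp add: assms(3))
    finally show "int (wt (codeword n f s (v @\<^sub>v w))) =
           Q - 1 + int p ^ m * of_bool (v = 0\<^sub>v m)
             + (-1) ^ wt_vec v * (int p - 1) ^ (m - wt_vec v)
               * (int p ^ r * of_bool (w = 0\<^sub>v r) - 1)"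
      by simp
  qed
  ultimately show ?thesis by blast
qed

end
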